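(* The complexity class $\mathbf{P}$, viewed as a set of languages and hence as a subset of $2^\omega$, is $\boldsymbol{\Sigma}^0_2$-complete: $\mathbf{P}\in\boldsymbol{\Sigma}^0_2$ and $\mathbf{P}\notin\boldsymbol{\Pi}^0_2$.
   Context: Binary strings are identified with natural numbers via a fixed effective enumeration of $\{0,1\}^{<\omega}$, so that a language (a set of binary strings) is identified with an element of the Cantor space $2^\omega$ (product topology). $\boldsymbol{\Sigma}^0_2$ is the class of countable unions of closed subsets of $2^\omega$; $\boldsymbol{\Pi}^0_2$ the class of countable intersections of open sets. *)

theory Defs
  imports "HOL-Analysis.Analysis" "HOL-Computational_Algebra.Polynomial"
begin

section \<open>Deterministic Turing machines\<close>

text \<open>
  Single-tape deterministic machines with a two-way infinite tape. States and tape symbols are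
  initial segments of the natural numbers; symbol 0 is the blank, symbols 1 and 2 are the input
  bits.
\<close>

datatype move = Move_Left | Move_Right | Stay

record tm =
  num_states :: nat
  num_symbols :: nat
  start :: nat
  accept :: nat
  reject :: nat
  delta :: "nat \<Rightarrow> nat \<Rightarrow> nat \<times> nat \<times> move"

definition turing_machine :: "tm \<Rightarrow> bool" where
  "turing_machine M \<longleftrightarrow>
     3 \<le> num_symbols M \<and>
     start M < num_states M \<and> accept M < num_states M \<and> reject M < num_states M \<and>
     accept M \<noteq> reject M \<and>
     (\<forall>q < num_states M. \<forall>a < num_symbols M.
        case delta M q a of (q', b, _) \<Rightarrow> q' < num_states M \<and> b < num_symbols M)"

record config =
  state :: nat
  head :: int
  tape :: "int \<Rightarrow> nat"

definition bit_symbol :: "bool \<Rightarrow> nat" where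
  "bit_symbol b = (if b then 2 else 1)"

text \<open>The input is written on cells 0, 1, ..., with the head on cell 0.\<close>

definition initial_config :: "tm \<Rightarrow> bool list \<Rightarrow> config" where
  "initial_config M w =
     \<lparr>state = start M, head = 0,
      tape = (\<lambda>i. if 0 \<le> i \<and> i < int (length w) then bit_symbol (w ! nat i) else 0)\<rparr>"

fun move_offset :: "move \<Rightarrow> int" where
  "move_offset Move_Left = - 1"
| "move_offset Move_Right = 1"
| "move_offset Stay = 0"

definition step :: "tm \<Rightarrow> config \<Rightarrow> config" where
  "step M c =
     (if state c = accept M \<or> state c = reject M then c
      else case delta M (state c) (tape c (head c)) of (q, b, d) \<Rightarrow>
        \<lparr>state = q, head = head c + move_offset d, tape = (tape c)(head c := b)\<rparr>)"

definition config_after :: "tm \<Rightarrow> bool list \<Rightarrow> nat \<Rightarrow> config" where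
  "config_after M w t = (step M ^^ t) (initial_config M w)"

text \<open>Halting configurations are fixed by \<open>step\<close>, so the following means that \<open>M\<close> halts within
  \<open>T (length w)\<close> steps on every input \<open>w\<close>, with the correct answer.\<close>

definition decides_in_time :: "tm \<Rightarrow> bool list set \<Rightarrow> (nat \<Rightarrow> nat) \<Rightarrow> bool" where
  "decides_in_time M L T \<longleftrightarrow>
     (\<forall>w. state (config_after M w (T (length w))) = (if w \<in> L then accept M else reject M))"

definition class_P :: "bool list set set" where
  "class_P = {L. \<exists>M (p :: nat poly). turing_machine M \<and> decides_in_time M L (poly p)}"

section \<open>Languages as points of Cantor space\<close>

text \<open>The enumeration of binary strings by length and then lexicographically:
  the empty string, 0, 1, 00, 01, 10, 11, 000, ...\<close>

fun string_of :: "nat \<Rightarrow> bool list" where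
  "string_of 0 = []"
| "string_of (Suc n) = string_of (n div 2) @ [odd n]"

lemma bij_string_of: "bij string_of"
proof (rule bijI)
  show "inj string_of"
  proof (rule injI)
    fix m n show "string_of m = string_of n \<Longrightarrow> m = n"
    proof (induction m arbitrary: n rule: string_of.induct)
      case 1
      then show ?case by (cases n) auto
    next
      case (2 m)
      then obtain k where n: "n = Suc k" by (cases n) auto
      with "2.prems" have "string_of (m div 2) = string_of (k div 2)" and par: "odd m = odd k"
        by auto
      then have "m div 2 = k div 2" using "2.IH" by blast
      with par have "m = k" by presburger
      with n show ?case by simp
    qed
  qed
  have "\<exists>n. string_of n = w" for w
  proof (induction w rule: rev_induct)
    case Nil
    show ?case by (rule exI[of _ 0]) simp
  next
    case (snoc b w)
    then obtain n where "string_of n = w" by blast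
    then have "string_of (Suc (2 * n + (if b then 1 else 0))) = w @ [b]" by simp
    then show ?case by blast
  qed
  then show "surj string_of" by (metis surjI)
qed

definition char_seq :: "bool list set \<Rightarrow> nat \<Rightarrow> bool" where
  "char_seq L = (\<lambda>n. string_of n \<in> L)"

definition cantor_space :: "(nat \<Rightarrow> bool) topology" where
  "cantor_space = product_topology (\<lambda>_. discrete_topology UNIV) UNIV"

end

theory Submission
  imports Defs
begin

text \<open>
  Up to relabelling of irrelevant transition values there are only countably many Turing machines,
  and each decides at most one language, so \<open>class_P\<close> is countable; points are closed, hence its
  image is \<open>F\<^sub>\<sigma>\<close>. Every finite language is in P, so the image is dense. A countable dense
  \<open>G\<^sub>\<delta>\<close> subset of a Baire space without isolated points is impossible: together with the
  complements of its points it would give countably many dense open sets with empty intersection.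
\<close>

section \<open>Countability of P\<close>

instance move :: countable
  by countable_datatype

text \<open>\<open>delta\<close> is a function on all pairs of naturals, so the type
  \<open>tm\<close> is uncountable. Only its finite table on actual states and symbols is recorded,
  which puts the code in a countable type.\<close>

definition tm_code :: "tm \<Rightarrow> nat \<times> nat \<times> nat \<times> nat \<times> nat \<times> (nat \<times> nat \<times> move) list list" where
  "tm_code M = (num_states M, num_symbols M, start M, accept M, reject M,
     map (\<lambda>q. map (delta M q) [0..<num_symbols M]) [0..<num_states M])"

text \<open>The invariant that keeps every transition lookup inside the table stored in
  \<open>tm_code\<close>.\<close>

definition valid_config :: "tm \<Rightarrow> config \<Rightarrow> bool" where
  "valid_config M c \<longleftrightarrow> state c < num_states M \<and> (\<forall>i. tape c i < num_symbols M)"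

lemma valid_config_initial:
  assumes "turing_machine M"
  shows "valid_config M (initial_config M w)"
  using assms by (auto simp: valid_config_def initial_config_def turing_machine_def bit_symbol_def)

lemma valid_config_step:
  assumes "turing_machine M" "valid_config M c"
  shows "valid_config M (step M c)"
proof -
  have "case delta M (state c) (tape c (head c)) of
      (q', b, _) \<Rightarrow> q' < num_states M \<and> b < num_symbols M"
    using assms by (auto simp: turing_machine_def valid_config_def)
  then show ?thesis
    using assms(2) by (auto simp: valid_config_def step_def split: prod.splits)
qed

lemma config_after_0 [simp]: "config_after M w 0 = initial_config M w"
  by (simp add: config_after_def)

lemma config_after_Suc [simp]: "config_after M w (Suc t) = step M (config_after M w t)"
  by (simp add: config_after_def)

lemma valid_config_config_after:
  assumes "turing_machine M"
  shows "valid_config M (config_after M w t)"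
  by (induction t) (simp_all add: assms valid_config_initial valid_config_step)

lemma step_cong_tm_code:
  assumes "tm_code M = tm_code M'" "valid_config M c"
  shows "step M c = step M' c"
proof -
  have "map (delta M q) [0..<num_symbols M] = map (delta M' q) [0..<num_symbols M]"
    if "q < num_states M" for q
    using assms(1) that by (auto simp: tm_code_def)
  then have "delta M (state c) (tape c (head c)) = delta M' (state c) (tape c (head c))"
    using assms(2) by (auto simp: valid_config_def)
  with assms(1) show ?thesis
    by (simp add: step_def tm_code_def)
qed

lemma config_after_cong_tm_code:
  assumes "turing_machine M" "tm_code M = tm_code M'"
  shows "config_after M w t = config_after M' w t"
proof (induction t)
  case 0
  then show ?case
    using assms(2) by (simp add: initial_config_def tm_code_def)
next
  case (Suc t)
  have "step M (config_after M w t) = step M' (config_after M w t)"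
    using assms by (intro step_cong_tm_code valid_config_config_after)
  with Suc show ?case by simp
qed

lemma config_after_halted:
  fixes M :: tm
  assumes "state (config_after M w t) \<in> {accept M, reject M}" "t \<le> t'"
  shows "config_after M w t' = config_after M w t"
  using assms(2,1) by (induction t' rule: dec_induct) (auto simp: step_def)

text \<open>The two time bounds may differ, so both runs are prolonged to the sum of the bounds.
  Both have halted by then, and equal codes make the two configurations equal.\<close>

lemma decides_in_time_unique:
  assumes M: "turing_machine M" "decides_in_time M L T"
    and M': "turing_machine M'" "decides_in_time M' L' T'"
    and code: "tm_code M = tm_code M'"
  shows "L = L'"
proof (rule set_eqI)
  fix w :: "bool list"
  let ?t = "T (length w) + T' (length w)"
  have "state (config_after M w ?t) = (if w \<in> L then accept M else reject M)"
    using M(2) config_after_halted[of M w "T (length w)" ?t] by (simp add: decides_in_time_def)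
  moreover have "state (config_after M' w ?t) = (if w \<in> L' then accept M' else reject M')"
    using M'(2) config_after_halted[of M' w "T' (length w)" ?t] by (simp add: decides_in_time_def)
  moreover have "config_after M w ?t = config_after M' w ?t"
    using M(1) code by (rule config_after_cong_tm_code)
  moreover have "accept M = accept M'" "reject M = reject M'" "accept M \<noteq> reject M"
    using M(1) code by (auto simp: tm_code_def turing_machine_def)
  ultimately show "w \<in> L \<longleftrightarrow> w \<in> L'"
    by (auto split: if_splits)
qed

lemma countable_class_P: "countable class_P"
proof -
  have "\<forall>L \<in> class_P. \<exists>M. turing_machine M \<and> (\<exists>T. decides_in_time M L T)"
    by (auto simp: class_P_def)
  then obtain f where f: "\<And>L. L \<in> class_P \<Longrightarrow> turing_machine (f L)"
      "\<And>L. L \<in> class_P \<Longrightarrow> \<exists>T. decides_in_time (f L) L T"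
    by metis
  \<comment> \<open>The code of a chosen decider determines the language, which embeds
    \<open>class_P\<close> into a countable type.\<close>
  have "inj_on (\<lambda>L. tm_code (f L)) class_P"
  proof (rule inj_onI)
    fix L L' assume LL': "L \<in> class_P" "L' \<in> class_P" "tm_code (f L) = tm_code (f L')"
    obtain T where T: "decides_in_time (f L) L T"
      using f(2)[OF LL'(1)] ..
    obtain T' where T': "decides_in_time (f L') L' T'"
      using f(2)[OF LL'(2)] ..
    show "L = L'"
      by (rule decides_in_time_unique[OF f(1)[OF LL'(1)] T f(1)[OF LL'(2)] T' LL'(3)])
  qed
  then show ?thesis
    by (rule countable_image_inj_on[OF countableI_type])
qed

section \<open>Finite languages\<close>

text \<open>The state reached after reading a string \<open>w\<close> is the \<open>string_of\<close>-index of \<open>w\<close>, as long as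
  this is below the bound \<open>N\<close>.\<close>

definition finite_tm :: "nat \<Rightarrow> bool list set \<Rightarrow> tm" where
  "finite_tm N L =
     \<lparr>num_states = N + 2, num_symbols = 3, start = 0, accept = N, reject = Suc N,
      delta = (\<lambda>q a.
        if a = 0 then (if string_of q \<in> L then N else Suc N, 0, Stay)
        else (if 2 * q + a < N then 2 * q + a else Suc N, a, Move_Right))\<rparr>"

lemma turing_machine_finite_tm: "turing_machine (finite_tm N L)"
  by (auto simp: turing_machine_def finite_tm_def)

text \<open>This identity justifies the transition \<open>2 * q + a\<close> of
  \<open>finite_tm\<close>: the symbols 1 and 2 are exactly the offsets from \<open>2 * q\<close> to
  the indices of the two one-bit extensions.\<close>

lemma string_of_bit: "string_of (2 * q + bit_symbol b) = string_of q @ [b]"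
proof -
  have "2 * q + bit_symbol b = Suc (2 * q + of_bool b)"
    by (simp add: bit_symbol_def)
  then show ?thesis by simp
qed

text \<open>Induction on the number of symbols read. The machine writes back each symbol it reads,
  so the tape stays unchanged. The index \<open>q\<close> of the prefix is tracked even after the
  machine has rejected.\<close>

lemma finite_tm_prefix:
  assumes "N > 0" "t \<le> length w"
  shows "\<exists>q. string_of q = take t w \<and>
    (if q < N
     then config_after (finite_tm N L) w t = (initial_config (finite_tm N L) w)\<lparr>state := q, head := int t\<rparr>
     else state (config_after (finite_tm N L) w t) = Suc N)"
  using assms(2)
proof (induction t)
  case 0
  show ?case
    \<comment> \<open>The empty prefix has index 0; \<open>N > 0\<close> puts it below the
      bound.\<close>
    by (rule exI[of _ 0]) (simp add: assms initial_config_def finite_tm_def)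
next
  case (Suc t)
  then obtain q where q: "string_of q = take t w"
    "if q < N
     then config_after (finite_tm N L) w t = (initial_config (finite_tm N L) w)\<lparr>state := q, head := int t\<rparr>
     else state (config_after (finite_tm N L) w t) = Suc N"
    by auto
  let ?q = "2 * q + bit_symbol (w ! t)"
  have pos: "bit_symbol (w ! t) \<noteq> 0"
    by (simp add: bit_symbol_def)
  have "string_of ?q = take (Suc t) w"
    using Suc.prems by (simp add: string_of_bit q(1) take_Suc_conv_app_nth)
  moreover have "if ?q < N
     then config_after (finite_tm N L) w (Suc t) =
       (initial_config (finite_tm N L) w)\<lparr>state := ?q, head := int (Suc t)\<rparr>
     else state (config_after (finite_tm N L) w (Suc t)) = Suc N"
  proof (cases "q < N")
    case True
    then show ?thesis
      using q(2) pos Suc.prems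
      by (auto simp: step_def finite_tm_def initial_config_def)
  next
    \<comment> \<open>Appending a bit only increases the index, so it stays at least
      \<open>N\<close>, and the rejecting state \<open>Suc N\<close> is never left.\<close>
    case False
    then show ?thesis
      using q(2) by (auto simp: step_def finite_tm_def)
  qed
  ultimately show ?case by blast
qed

text \<open>Reading the input takes \<open>length w\<close> steps; the extra step looks up the
  answer on the blank behind it. An index of \<open>N\<close> or more belongs to no word of
  \<open>L\<close>, by injectivity of \<open>string_of\<close>.\<close>

lemma finite_tm_decides:
  assumes "N > 0" "L \<subseteq> string_of ` {..<N}"
  shows "decides_in_time (finite_tm N L) L Suc"
  unfolding decides_in_time_def
proof
  fix w
  obtain q where q: "string_of q = w"
    "if q < N
     then config_after (finite_tm N L) w (length w) =
       (initial_config (finite_tm N L) w)\<lparr>state := q, head := int (length w)\<rparr>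
     else state (config_after (finite_tm N L) w (length w)) = Suc N"
    using finite_tm_prefix[OF assms(1), of "length w" w L] by auto
  show "state (config_after (finite_tm N L) w (Suc (length w))) =
      (if w \<in> L then accept (finite_tm N L) else reject (finite_tm N L))"
  proof (cases "q < N")
    case True
    then show ?thesis
      using q by (simp add: step_def finite_tm_def initial_config_def)
  next
    case False
    have "w \<notin> L"
      using assms(2) False q(1) bij_is_inj[OF bij_string_of] by (auto dest: injD)
    then show ?thesis
      using q(2) False by (simp add: step_def finite_tm_def)
  qed
qed

lemma finite_in_class_P:
  assumes "finite L"
  shows "L \<in> class_P"
proof -
  obtain A where A: "finite A" "L = string_of ` A"
    using assms bij_is_surj[OF bij_string_of] by (metis finite_subset_image subset_UNIV)
  then obtain N where "A \<subseteq> {..<N}"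
    using finite_nat_iff_bounded by blast
  \<comment> \<open>The bound is raised by one to make it positive, also for empty
    \<open>L\<close>.\<close>
  then have "L \<subseteq> string_of ` {..<Suc N}"
    using A(2) by auto
  then have "decides_in_time (finite_tm (Suc N) L) L Suc"
    by (intro finite_tm_decides) auto
  moreover have "Suc = poly [:1, 1:]"
    by auto
  ultimately show ?thesis
    unfolding class_P_def using turing_machine_finite_tm by (metis (mono_tags, lifting) mem_Collect_eq)
qed

section \<open>Topology\<close>

lemma countable_imp_fsigma_in:
  assumes "t1_space X" "countable S" "S \<subseteq> topspace X"
  shows "fsigma_in X S"
proof -
  have "fsigma_in X (\<Union> ((\<lambda>x. {x}) ` S))"
    using assms by (intro fsigma_in_Union) (auto intro!: closed_imp_fsigma_in simp: t1_space_closedin_singleton)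
  then show ?thesis by simp
qed

lemma countable_dense_not_gdelta_in:
  assumes X: "completely_metrizable_space X \<or> locally_compact_space X \<and> regular_space X"
    and "t1_space X" "topspace X \<noteq> {}"
    and perfect: "\<And>x. \<not> openin X {x}"
    and S: "countable S" "X closure_of S = topspace X"
  shows "\<not> gdelta_in X S"
proof
  assume "gdelta_in X S"
  then obtain C where C: "\<And>n::nat. openin X (C n)" "\<Inter>(range C) = S"
    by (auto simp: gdelta_in_descending)
  have "S \<subseteq> topspace X"
    using \<open>gdelta_in X S\<close> by (rule gdelta_in_subset)
  \<comment> \<open>The sets \<open>C n\<close> intersect to \<open>S\<close>, and the point
    complements then remove every element of \<open>S\<close>.\<close>
  let ?G = "range C \<union> (\<lambda>x. topspace X - {x}) ` S"
  have "X closure_of \<Inter>?G = topspace X"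
  proof (rule Baire_category[OF X])
    show "countable ?G"
      using S(1) by simp
  next
    fix T assume "T \<in> ?G"
    then consider n where "T = C n" | x where "x \<in> S" "T = topspace X - {x}"
      by auto
    then show "openin X T \<and> X closure_of T = topspace X"
    proof cases
      case 1
      have "S \<subseteq> T"
        using C(2) 1 by blast
      then have "topspace X \<subseteq> X closure_of T"
        using closure_of_mono S(2) by metis
      then have "X closure_of T = topspace X"
        by (intro subset_antisym closure_of_subset_topspace)
      with C(1)[of n] show ?thesis
        unfolding 1 ..
    next
      case 2
      have "x \<in> topspace X"
        using 2(1) \<open>S \<subseteq> topspace X\<close> by (rule rev_subsetD)
      with \<open>t1_space X\<close> have "closedin X {x}"
        by (simp add: t1_space_closedin_singleton)
      \<comment> \<open>Equivalent to density of the complement of \<open>x\<close>; a nonempty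
        interior would make \<open>{x}\<close> open.\<close>
      moreover have "X interior_of {x} = {}"
      proof (rule ccontr)
        assume "X interior_of {x} \<noteq> {}"
        then have "X interior_of {x} = {x}"
          using subset_singletonD[OF interior_of_subset] by metis
        then show False
          using perfect[of x] openin_interior_of[of X "{x}"] by simp
      qed
      ultimately show ?thesis
        unfolding 2(2) by (simp add: closure_of_complement openin_diff)
    qed
  qed
  moreover have "\<Inter>?G = {}"
  proof -
    have "\<Inter>?G = S \<inter> (\<Inter>x\<in>S. topspace X - {x})"
      unfolding Inter_Un_distrib C(2) ..
    also have "\<dots> = {}" by blast
    finally show ?thesis .
  qed
  ultimately show False
    using \<open>topspace X \<noteq> {}\<close> by simp
qed

section \<open>Cantor space and the density of P\<close>

lemma topspace_cantor_space [simp]: "topspace cantor_space = UNIV"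
  by (simp add: cantor_space_def)

lemma compact_space_cantor_space: "compact_space cantor_space"
  by (simp add: cantor_space_def compact_space_product_topology compact_space_discrete_topology)

lemma Hausdorff_space_cantor_space: "Hausdorff_space cantor_space"
  by (simp add: cantor_space_def Hausdorff_space_product_topology)

text \<open>A basic open box restricts only finitely many coordinates, and \<open>N\<close> is
  chosen beyond all of them.\<close>

lemma cantor_space_open_prefix:
  assumes "openin cantor_space U" "x \<in> U"
  obtains N where "\<And>y. (\<And>i. i < N \<Longrightarrow> y i = x i) \<Longrightarrow> y \<in> U"
proof -
  obtain V where V: "finite {i. V i \<noteq> UNIV}" "x \<in> Pi\<^sub>E UNIV V" "Pi\<^sub>E UNIV V \<subseteq> U"
    using assms unfolding cantor_space_def openin_product_topology_alt by fastforce
  then obtain N where N: "{i. V i \<noteq> UNIV} \<subseteq> {..<N}"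
    using finite_nat_iff_bounded by blast
  have "y \<in> U" if "\<And>i. i < N \<Longrightarrow> y i = x i" for y
  proof -
    have "y i \<in> V i" for i
      using N V(2) that[of i] by (cases "i < N") (auto simp: PiE_iff)
    then show ?thesis
      using V(3) by (auto simp: PiE_iff)
  qed
  then show thesis using that by blast
qed

lemma not_openin_cantor_space_singleton: "\<not> openin cantor_space {x}"
proof
  assume "openin cantor_space {x}"
  then obtain N where N: "\<And>y. (\<And>i. i < N \<Longrightarrow> y i = x i) \<Longrightarrow> y \<in> {x}"
    using cantor_space_open_prefix by blast
  \<comment> \<open>Flipping coordinate \<open>N\<close> leaves the prefix below \<open>N\<close>
    intact.\<close>
  have "x(N := \<not> x N) = x"
    using N[of "x(N := \<not> x N)"] by simp
  then show False
    by (metis fun_upd_same)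
qed

lemma dense_class_P: "cantor_space closure_of (char_seq ` class_P) = topspace cantor_space"
proof -
  have "\<exists>y \<in> char_seq ` class_P. y \<in> U" if U: "openin cantor_space U" "x \<in> U" for x U
  proof -
    obtain N where N: "\<And>y. (\<And>i. i < N \<Longrightarrow> y i = x i) \<Longrightarrow> y \<in> U"
      using cantor_space_open_prefix[OF U] by blast
    \<comment> \<open>The finite language whose characteristic sequence copies \<open>x\<close>
      below \<open>N\<close> and is false from there on.\<close>
    let ?L = "string_of ` {i. i < N \<and> x i}"
    have "char_seq ?L i = x i" if "i < N" for i
      using that bij_is_inj[OF bij_string_of] by (auto simp: char_seq_def dest: injD)
    then have "char_seq ?L \<in> U"
      by (rule N)
    moreover have "?L \<in> class_P"
      by (rule finite_in_class_P) simp
    ultimately show ?thesis by blast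
  qed
  then show ?thesis
    by (auto simp: in_closure_of)
qed

theorem theorem2p15:
  shows "fsigma_in cantor_space (char_seq ` class_P) \<and>
         \<not> gdelta_in cantor_space (char_seq ` class_P)"
proof
  have t1: "t1_space cantor_space"
    by (rule Hausdorff_imp_t1_space[OF Hausdorff_space_cantor_space])
  have countable: "countable (char_seq ` class_P)"
    using countable_class_P by simp
  show "fsigma_in cantor_space (char_seq ` class_P)"
    using t1 countable by (rule countable_imp_fsigma_in) simp
  \<comment> \<open>The second alternative in the hypothesis of the Baire category argument.\<close>
  have "locally_compact_space cantor_space \<and> regular_space cantor_space"
    using compact_space_cantor_space Hausdorff_space_cantor_space
    by (simp add: compact_imp_locally_compact_space compact_Hausdorff_imp_regular_space)
  then show "\<not> gdelta_in cantor_space (char_seq ` class_P)"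
    using t1 not_openin_cantor_space_singleton countable dense_class_P
    by (intro countable_dense_not_gdelta_in) simp_all
qed

end
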